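(* Let $n,p\in\{1,2,3,\ldots\}$, let $A,B\in\mathbb{R}^{p\times n}$ with $\operatorname{rank}(A\ B)=p$, and let $G:\mathbb{R}^n\rightrightarrows\mathbb{R}^n$ be the linear relation with $\operatorname{gra} G=\{(x,x^* )\in\mathbb{R}^n\times\mathbb{R}^n\mid Ax+Bx^*=0\}$. Let $v_1,\ldots,v_p$ be an orthonormal basis of $\mathbb{R}^p$ consisting of eigenvectors of $AB^{\intercal}+BA^{\intercal}$ with eigenvalues $\lambda_1,\ldots,\lambda_p$ respectively, where all positive eigenvalues are listed first, and put $V=[v_1\ v_2\ \cdots\ v_p]\in\mathbb{R}^{p\times p}$ and $\mathrm{Id}_\lambda=\operatorname{diag}(\lambda_1,\ldots,\lambda_p)$. Suppose $G$ is monotone, and let $\widetilde G:\mathbb{R}^n\rightrightarrows\mathbb{R}^n$ be a linear relation. Then $\widetilde G$ is a maximally monotone extension of $G$ if and only if there exists $N\in\mathbb{R}^{p\times p}$ with $\operatorname{rank}N=n$ such that $N^{\intercal}\,\mathrm{Id}_\lambda\, N$ is negative semidefinite and $$\operatorname{gra}\widetilde G=\{(x,x^* )\mid N^{\intercal}V^{\intercal}Ax+N^{\intercal}V^{\intercal}Bx^*=0\}.$$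
   Context: $\mathbb{R}^n$ carries the Euclidean inner product $\langle\cdot,\cdot\rangle$. A set-valued operator $T:\mathbb{R}^n\rightrightarrows\mathbb{R}^n$ is identified with its graph $\operatorname{gra}T=\{(x,x^* )\mid x^*\in Tx\}$; it is a linear relation if $\operatorname{gra}T$ is a linear subspace. $T$ is monotone if $\langle x-y,x^*-y^*\rangle\ge0$ for all $(x,x^* ),(y,y^* )\in\operatorname{gra}T$, and maximally monotone if it is monotone and has no proper monotone extension (in the sense of graph inclusion, among all set-valued operators). $S$ is an extension of $T$ if $\operatorname{gra}T\subseteq\operatorname{gra}S$. *)

theory Defs
  imports "HOL-Analysis.Analysis"
begin

text \<open>Set-valued operators are functions into sets.\<close>

definition gra :: "('a \<Rightarrow> 'b set) \<Rightarrow> ('a \<times> 'b) set" where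
  "gra T = {(x, y). y \<in> T x}"

definition linear_relation :: "('a::real_vector \<Rightarrow> 'b::real_vector set) \<Rightarrow> bool" where
  "linear_relation T \<longleftrightarrow> subspace (gra T)"

definition extension_of :: "('a \<Rightarrow> 'b set) \<Rightarrow> ('a \<Rightarrow> 'b set) \<Rightarrow> bool" where
  "extension_of S T \<longleftrightarrow> gra T \<subseteq> gra S"

definition monotone_operator :: "('a::real_inner \<Rightarrow> 'a set) \<Rightarrow> bool" where
  "monotone_operator T \<longleftrightarrow>
     (\<forall>(x, x')\<in>gra T. \<forall>(y, y')\<in>gra T. 0 \<le> (x - y) \<bullet> (x' - y'))"

definition maximally_monotone :: "('a::real_inner \<Rightarrow> 'a set) \<Rightarrow> bool" where
  "maximally_monotone T \<longleftrightarrow>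
     monotone_operator T \<and>
     (\<forall>S. monotone_operator S \<and> extension_of S T \<longrightarrow> gra S = gra T)"

text \<open>The block matrix \<open>(A B)\<close>; its columns are indexed by a disjoint sum.\<close>

definition block_row :: "real^'n^'p \<Rightarrow> real^'m^'p \<Rightarrow> real^('n + 'm)^'p" where
  "block_row A B = (\<chi> i j. case j of Inl k \<Rightarrow> A $ i $ k | Inr k \<Rightarrow> B $ i $ k)"

definition diag :: "('p \<Rightarrow> real) \<Rightarrow> real^'p^'p" where
  "diag d = (\<chi> i j. if i = j then d i else 0)"

definition matrix_of_columns :: "('m \<Rightarrow> real^'p) \<Rightarrow> real^'m^'p" where
  "matrix_of_columns v = (\<chi> i j. v j $ i)"

definition orthonormal_basis :: "('p \<Rightarrow> 'a::euclidean_space) \<Rightarrow> bool" where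
  "orthonormal_basis v \<longleftrightarrow>
     (\<forall>i j. v i \<bullet> v j = (if i = j then 1 else 0)) \<and> span (range v) = UNIV"

definition eigenvector :: "real^'p^'p \<Rightarrow> real^'p \<Rightarrow> real \<Rightarrow> bool" where
  "eigenvector M v l \<longleftrightarrow> v \<noteq> 0 \<and> M *v v = l *\<^sub>R v"

definition negative_semidefinite :: "real^'p^'p \<Rightarrow> bool" where
  "negative_semidefinite M \<longleftrightarrow> transpose M = M \<and> (\<forall>x. x \<bullet> (M *v x) \<le> 0)"

end

theory Submission
  imports Defs
begin

text \<open>
  On \<open>'a \<times> 'a\<close> consider the quadratic form \<open>q (x, y) = x \<bullet> y\<close> and the isometry
  \<open>prod.swap\<close>, which preserves \<open>q\<close> and for which \<open>2 * q u = u \<bullet> prod.swap u\<close>. A subspace on which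
  \<open>q\<close> is semidefinite meets one of the two diagonals trivially, so its dimension is at most that of \<open>'a\<close>.
  If \<open>q\<close> is nonnegative on \<open>W\<close> and \<open>q u > 0\<close> for some \<open>u\<close> orthogonal to \<open>W\<close>, then \<open>q\<close> is also nonnegative on
  the strictly larger subspace spanned by \<open>W\<close> and \<open>prod.swap u\<close>. Hence a linear relation is maximally
  monotone iff the orthogonal complement of its graph has the dimension of \<open>'a\<close> and \<open>q\<close> is nonpositive there.
  A relation containing the kernel of \<open>(A B)\<close> has the orthogonal complement of its graph inside
  the row space of \<open>(A B)\<close>; the matrix \<open>V ** N\<close> parametrises that complement, and in the coordinates
  given by \<open>V\<close> the form \<open>2 * q\<close> on the row space becomes \<open>diag lam\<close>.
\<close>

section \<open>Orthogonal complements and one-vector extensions of a subspace\<close>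

lemma inner_swap_self: "u \<bullet> prod.swap u = 2 * (fst u \<bullet> snd u)"
  by (cases u) (simp add: inner_commute)

lemma orthogonal_comp_iff: "u \<in> W\<^sup>\<bottom> \<longleftrightarrow> (\<forall>w\<in>W. u \<bullet> w = 0)"
  by (simp add: orthogonal_comp_def orthogonal_def inner_commute)

lemma span_insert_subspaceE:
  assumes "subspace W" "y \<in> span (insert x W)"
  obtains w k where "w \<in> W" "y = w + k *\<^sub>R x"
proof -
  obtain k where "y - k *\<^sub>R x \<in> W"
    using assms by (auto simp: span_insert span_eq_iff[THEN iffD2, OF assms(1)])
  then show thesis
    using that[of "y - k *\<^sub>R x" k] by simp
qed

lemma dim_orthogonal_comp:
  fixes W :: "'a::euclidean_space set"
  assumes "subspace W"
  shows "dim (W\<^sup>\<bottom>) + dim W = DIM('a)"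
  using dim_subspace_orthogonal_to_vectors[OF assms subspace_UNIV]
  by (simp add: orthogonal_comp_def)

section \<open>Subspaces on which \<open>q\<close> is semidefinite\<close>

text \<open>The scalar \<open>s\<close> is a sign, so that both kinds of semidefiniteness are treated at once.\<close>

definition semidefinite_on :: "real \<Rightarrow> ('a::real_inner \<times> 'a) set \<Rightarrow> bool" where
  "semidefinite_on s W \<longleftrightarrow> (\<forall>w\<in>W. 0 \<le> s * (fst w \<bullet> snd w))"

text \<open>The map \<open>?h\<close> into \<open>'a\<close> is injective on \<open>W\<close>: where
  it vanishes, \<open>s * q\<close> equals minus the squared norm of
  \<open>s *\<^sub>R snd w\<close>, so semidefiniteness forces \<open>w = 0\<close>.\<close>

lemma dim_semidefinite_le:
  fixes W :: "('a::euclidean_space \<times> 'a) set"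
  assumes W: "subspace W" and pos: "semidefinite_on s W" and s: "s \<noteq> 0"
  shows "dim W \<le> DIM('a)"
proof -
  let ?h = "\<lambda>w::'a \<times> 'a. fst w + s *\<^sub>R snd w"
  have lin: "linear ?h"
    by (intro linearI) (auto simp: algebra_simps)
  have "w = 0" if "w \<in> W" "?h w = 0" for w
  proof -
    have w1: "fst w = - (s *\<^sub>R snd w)"
      using that(2) by (simp add: eq_neg_iff_add_eq_0)
    have "0 \<le> s * (fst w \<bullet> snd w)"
      using pos that(1) by (simp add: semidefinite_on_def)
    then have "(s * s) * (snd w \<bullet> snd w) \<le> 0"
      by (simp add: w1)
    then have "snd w \<bullet> snd w \<le> 0"
      using s by (auto simp: mult_le_0_iff)
    then have "snd w = 0"
      by (metis inner_gt_zero_iff linorder_not_le)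
    with w1 show ?thesis by (simp add: prod_eq_iff)
  qed
  then have "inj_on ?h W"
    using linear_injective_on_subspace_0[OF lin W] by blast
  then have "dim W = dim (?h ` W)"
    using dim_image_eq[OF lin] W by (metis span_eq_iff)
  then show ?thesis
    by (simp add: dim_subset_UNIV)
qed

text \<open>Expanding \<open>q\<close> at \<open>w + k *\<^sub>R prod.swap u\<close>, the mixed term
  is \<open>k * (u \<bullet> w)\<close>, which orthogonality kills; the remaining terms have the
  right sign. The new vector lies outside \<open>W\<close> because
  \<open>u \<bullet> prod.swap u\<close> is nonzero.\<close>

lemma semidefinite_on_insert_swap:
  assumes W: "subspace W" and pos: "semidefinite_on s W"
    and u: "u \<in> W\<^sup>\<bottom>" and su: "0 < s * (fst u \<bullet> snd u)"
  shows "semidefinite_on s (span (insert (prod.swap u) W))" and "prod.swap u \<notin> W"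
proof -
  show "prod.swap u \<notin> W"
    using u su inner_swap_self[of u] by (auto simp: orthogonal_comp_iff)
  have "0 \<le> s * (fst z \<bullet> snd z)" if z_span: "z \<in> span (insert (prod.swap u) W)" for z
  proof -
    obtain w k where w: "w \<in> W" and z: "z = w + k *\<^sub>R prod.swap u"
      using span_insert_subspaceE[OF W z_span] .
    have "u \<bullet> w = 0"
      using u w by (simp add: orthogonal_comp_iff)
    then have "fst u \<bullet> fst w + snd u \<bullet> snd w = 0"
      by (simp add: inner_prod_def)
    moreover have "fst z \<bullet> snd z = fst w \<bullet> snd w
        + k * (fst u \<bullet> fst w + snd u \<bullet> snd w) + k\<^sup>2 * (fst u \<bullet> snd u)"
      by (simp add: z inner_add_left inner_add_right power2_eq_square distrib_left
          inner_commute[of "fst w" "fst u"] inner_commute[of "snd u" "fst u"])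
    ultimately have "fst z \<bullet> snd z = fst w \<bullet> snd w + k\<^sup>2 * (fst u \<bullet> snd u)"
      by simp
    moreover have "0 \<le> s * (fst w \<bullet> snd w)"
      using pos w by (simp add: semidefinite_on_def)
    moreover have "0 \<le> k\<^sup>2 * (s * (fst u \<bullet> snd u))"
      using su by simp
    ultimately show ?thesis
      by (simp add: algebra_simps)
  qed
  then show "semidefinite_on s (span (insert (prod.swap u) W))"
    by (simp add: semidefinite_on_def)
qed

text \<open>A vector of the complement with the wrong sign would allow an enlargement of
  \<open>W\<close> beyond the maximal dimension of a semidefinite subspace.\<close>

lemma semidefinite_on_orthogonal_comp:
  fixes W :: "('a::euclidean_space \<times> 'a) set"
  assumes W: "subspace W" and pos: "semidefinite_on s W" and s: "s \<noteq> 0"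
    and dim: "dim W = DIM('a)"
  shows "semidefinite_on (- s) (W\<^sup>\<bottom>)"
proof -
  have False if u: "u \<in> W\<^sup>\<bottom>" and su: "0 < s * (fst u \<bullet> snd u)" for u
  proof -
    note ins = semidefinite_on_insert_swap[OF W pos u su]
    have "dim (span (insert (prod.swap u) W)) = DIM('a) + 1"
      using ins(2) W dim by (metis dim_insert dim_span span_eq_iff)
    then show False
      using dim_semidefinite_le[OF subspace_span ins(1) s] by simp
  qed
  then show ?thesis
    unfolding semidefinite_on_def mult_minus_left neg_0_le_iff_le by (meson linorder_not_le)
qed

section \<open>Monotone and maximally monotone linear relations\<close>

lemma monotone_linear_relation_iff:
  assumes "linear_relation T"
  shows "monotone_operator T \<longleftrightarrow> semidefinite_on 1 (gra T)"
proof
  have sub: "subspace (gra T)"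
    using assms by (simp add: linear_relation_def)
  show "semidefinite_on 1 (gra T)" if mono: "monotone_operator T"
    unfolding semidefinite_on_def
  proof
    fix w assume "w \<in> gra T"
    moreover have "(0, 0) \<in> gra T"
      using subspace_0[OF sub] by (simp add: zero_prod_def)
    ultimately show "0 \<le> 1 * (fst w \<bullet> snd w)"
      using mono unfolding monotone_operator_def by (cases w) fastforce
  qed
  show "monotone_operator T" if pos: "semidefinite_on 1 (gra T)"
  proof -
    have "0 \<le> (x - y) \<bullet> (x' - y')" if "(x, x') \<in> gra T" "(y, y') \<in> gra T" for x x' y y'
      using pos subspace_diff[OF sub that] by (simp add: semidefinite_on_def) fastforce
    then show ?thesis
      unfolding monotone_operator_def by blast
  qed
qed

lemma gra_of_set: "gra (\<lambda>x. {y. (x, y) \<in> S}) = S"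
  by (auto simp: gra_def)

proposition maximally_monotone_linear_relation_iff:
  fixes T :: "'a::euclidean_space \<Rightarrow> 'a set"
  assumes lin: "linear_relation T"
  shows "maximally_monotone T \<longleftrightarrow>
    dim ((gra T)\<^sup>\<bottom>) = DIM('a) \<and> semidefinite_on (- 1) ((gra T)\<^sup>\<bottom>)"
proof
  let ?W = "gra T"
  have W: "subspace ?W"
    using lin by (simp add: linear_relation_def)
  have dims: "dim (?W\<^sup>\<bottom>) + dim ?W = 2 * DIM('a)"
    using dim_orthogonal_comp[OF W] by simp
  {
    assume max: "maximally_monotone T"
    then have pos: "semidefinite_on 1 ?W"
      using monotone_linear_relation_iff[OF lin] by (simp add: maximally_monotone_def)
    have False if u: "u \<in> ?W\<^sup>\<bottom>" and su: "0 < 1 * (fst u \<bullet> snd u)" for u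
    proof -
      note ins = semidefinite_on_insert_swap[OF W pos u su]
      \<comment> \<open>A linear relation that would properly extend \<open>T\<close> and still be
        monotone.\<close>
      let ?S = "\<lambda>x. {y. (x, y) \<in> span (insert (prod.swap u) ?W)}"
      have "linear_relation ?S"
        by (simp add: linear_relation_def gra_of_set)
      then have "monotone_operator ?S"
        using ins(1) by (simp add: monotone_linear_relation_iff gra_of_set)
      moreover have "extension_of ?S T"
        by (auto simp: extension_of_def gra_of_set intro: span_base)
      ultimately have "gra ?S = ?W"
        using max by (simp add: maximally_monotone_def)
      then show False
        using ins(2) by (simp add: gra_of_set) (metis insertI1 span_base)
    qed
    then have neg: "semidefinite_on (- 1) (?W\<^sup>\<bottom>)"
      unfolding semidefinite_on_def mult_minus_left neg_0_le_iff_le by (meson linorder_not_le)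
    \<comment> \<open>Two dimensions bounded by \<open>DIM('a)\<close> with sum
      \<open>2 * DIM('a)\<close> must both attain the bound.\<close>
    have "dim ?W \<le> DIM('a)" "dim (?W\<^sup>\<bottom>) \<le> DIM('a)"
      using dim_semidefinite_le[OF W pos]
        dim_semidefinite_le[OF subspace_orthogonal_comp neg] by auto
    with dims neg show "dim (?W\<^sup>\<bottom>) = DIM('a) \<and> semidefinite_on (- 1) (?W\<^sup>\<bottom>)"
      by simp
  next
    assume "dim (?W\<^sup>\<bottom>) = DIM('a) \<and> semidefinite_on (- 1) (?W\<^sup>\<bottom>)"
    then have dim: "dim (?W\<^sup>\<bottom>) = DIM('a)" and neg: "semidefinite_on (- 1) (?W\<^sup>\<bottom>)"
      by auto
    \<comment> \<open>Duality applied to the complement with \<open>s = - 1\<close>; the double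
      complement gives back \<open>?W\<close>.\<close>
    have pos: "semidefinite_on 1 ?W"
      using semidefinite_on_orthogonal_comp[OF subspace_orthogonal_comp neg _ dim]
      by (simp add: orthogonal_comp_self[OF W])
    \<comment> \<open>Maximality is tested against arbitrary \<open>S\<close>, so only differences
      of \<open>z\<close> with points of \<open>?W\<close> are known to have the right sign; scaling
      transfers this to the whole span of \<open>z\<close> and \<open>?W\<close>.\<close>
    have "gra S = ?W" if S: "monotone_operator S" and ext: "extension_of S T" for S
    proof
      show "?W \<subseteq> gra S"
        using ext by (simp add: extension_of_def)
      show "gra S \<subseteq> ?W"
      proof
        fix z assume z: "z \<in> gra S"
        have diff: "0 \<le> fst (z - w) \<bullet> snd (z - w)" if "w \<in> ?W" for w
        proof -
          have "w \<in> gra S"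
            using that ext by (auto simp: extension_of_def)
          with S z show ?thesis
            unfolding monotone_operator_def by (cases z; cases w) fastforce
        qed
        have "0 \<le> fst y \<bullet> snd y" if "y \<in> span (insert z ?W)" for y
        proof -
          obtain w k where w: "w \<in> ?W" and y: "y = w + k *\<^sub>R z"
            using span_insert_subspaceE[OF W \<open>y \<in> span (insert z ?W)\<close>] .
          show ?thesis
          proof (cases "k = 0")
            case True
            then show ?thesis using pos w y by (simp add: semidefinite_on_def)
          next
            case False
            \<comment> \<open>Chosen so that \<open>y\<close> is a multiple of a difference
              \<open>z - ?w\<close> with \<open>?w\<close> in \<open>?W\<close>.\<close>
            let ?w = "(- 1 / k) *\<^sub>R w"
            have "y = k *\<^sub>R (z - ?w)"
              using False by (simp add: y algebra_simps)
            then have "fst y \<bullet> snd y = k\<^sup>2 * (fst (z - ?w) \<bullet> snd (z - ?w))"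
              by (simp only: fst_scaleR snd_scaleR inner_scaleR_left inner_scaleR_right
                  power2_eq_square mult.assoc)
            then show ?thesis
              using diff[OF subspace_scale[OF W w]] by (metis mult_nonneg_nonneg zero_le_power2)
          qed
        qed
        then have "semidefinite_on 1 (span (insert z ?W))"
          by (simp add: semidefinite_on_def)
        then have "dim (span (insert z ?W)) \<le> DIM('a)"
          by (intro dim_semidefinite_le) auto
        \<comment> \<open>\<open>?W\<close> already has the maximal dimension
          \<open>DIM('a)\<close>, so \<open>z\<close> cannot be a new direction.\<close>
        then have "dim (insert z ?W) \<le> dim ?W"
          using dims dim by simp
        then show "z \<in> ?W"
          using W by (metis dim_insert linorder_not_le less_add_one span_eq_iff)
      qed
    qed
    with pos show "maximally_monotone T"
      unfolding maximally_monotone_def monotone_linear_relation_iff[OF lin] by blast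
  }
qed

section \<open>The row space of \<open>(A B)\<close> and the form on it\<close>

text \<open>This is the adjoint of \<open>(x, x') \<mapsto> A *v x + B *v x'\<close>, kept as a pair
  so that \<open>q\<close> applies to its values.\<close>

definition row_map :: "real^'n^'p \<Rightarrow> real^'n^'p \<Rightarrow> real^'p \<Rightarrow> (real^'n) \<times> (real^'n)" where
  "row_map A B c = (transpose A *v c, transpose B *v c)"

lemma linear_row_map: "linear (row_map A B)"
  by (intro linearI) (auto simp: row_map_def matrix_vector_right_distrib matrix_vector_mult_scaleR)

lemma inner_matrix_vector_mult: "(transpose A *v c) \<bullet> x = c \<bullet> (A *v x)"
  for A :: "real^'n^'p"
  by (metis dot_lmul_matrix vector_transpose_matrix transpose_transpose)

lemma inner_row_map: "row_map A B c \<bullet> (x, x') = c \<bullet> (A *v x + B *v x')"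
  by (simp add: row_map_def inner_matrix_vector_mult inner_add_right
      del: transpose_matrix_vector)

text \<open>Up to splitting the coordinates, \<open>row_map A B\<close> is the transpose of the
  block matrix, whose columns are independent by full row rank.\<close>

lemma inj_row_map:
  fixes A B :: "real^'n^'p"
  assumes "rank (block_row A B) = CARD('p)"
  shows "inj (row_map A B)"
proof (rule linear_injective_0[OF linear_row_map, THEN iffD2], intro allI impI)
  fix c assume c: "row_map A B c = 0"
  have "rank (transpose (block_row A B)) = CARD('p)"
    using assms by (simp add: rank_transpose)
  then have inj: "inj ((*v) (transpose (block_row A B)))"
    using full_rank_injective by blast
  have "(transpose (block_row A B) *v c) $ k = 0" for k
    using c
    by (cases k) (auto simp: row_map_def zero_prod_def vec_eq_iff matrix_vector_mult_def
        transpose_def block_row_def)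
  then have "transpose (block_row A B) *v c = transpose (block_row A B) *v 0"
    by (simp add: vec_eq_iff)
  then show "c = 0"
    using inj by (meson injD)
qed

text \<open>Identifies the symmetric matrix of the theorem as that of \<open>2 * q\<close> pulled
  back along \<open>row_map A B\<close>.\<close>

lemma row_map_quadratic_form:
  "c \<bullet> ((A ** transpose B + B ** transpose A) *v c)
    = 2 * (fst (row_map A B c) \<bullet> snd (row_map A B c))"
  using inner_matrix_vector_mult[of A c "transpose B *v c"]
    inner_matrix_vector_mult[of B c "transpose A *v c"]
  by (simp add: row_map_def matrix_vector_mult_add_rdistrib inner_add_right
      matrix_vector_mul_assoc[symmetric] inner_commute)

section \<open>Diagonalisation and congruence\<close>

lemma orthonormal_columns:
  assumes "orthonormal_basis v"
  shows "transpose (matrix_of_columns v) ** matrix_of_columns v = mat 1"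
  using assms
  by (simp add: orthonormal_basis_def vec_eq_iff matrix_matrix_mult_def transpose_def
      matrix_of_columns_def mat_def inner_vec_def)

lemma eigenvector_columns:
  fixes v :: "'p::finite \<Rightarrow> real^'p"
  assumes "\<forall>i. eigenvector M (v i) (lam i)"
  shows "M ** matrix_of_columns v = matrix_of_columns v ** diag lam"
proof -
  have "(M *v v j) $ i = (lam j *\<^sub>R v j) $ i" for i j
    using assms by (simp add: eigenvector_def)
  then show ?thesis
    by (simp add: vec_eq_iff matrix_matrix_mult_def matrix_vector_mult_def
        matrix_of_columns_def diag_def if_distrib[of "\<lambda>x. _ * x"] sum.delta mult.commute
        cong: if_cong)
qed

lemma negative_semidefinite_congruence_iff:
  fixes N :: "real^'n^'p"
  shows "negative_semidefinite (transpose N ** diag d ** N) \<longleftrightarrow>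
    (\<forall>y. (N *v y) \<bullet> (diag d *v (N *v y)) \<le> 0)"
proof -
  have "transpose (diag d) = diag d"
    by (auto simp: vec_eq_iff transpose_def diag_def)
  then have "transpose (transpose N ** diag d ** N) = transpose N ** diag d ** N"
    by (simp add: matrix_transpose_mul matrix_mul_assoc)
  moreover have "y \<bullet> ((transpose N ** diag d ** N) *v y) = (N *v y) \<bullet> (diag d *v (N *v y))" for y
    using inner_matrix_vector_mult[of "transpose N" y "diag d *v (N *v y)"]
    by (simp add: matrix_vector_mul_assoc matrix_mul_assoc)
  ultimately show ?thesis
    by (simp add: negative_semidefinite_def)
qed

text \<open>A vector is zero iff it is orthogonal to every \<open>y\<close>, and \<open>K\<close>,
  \<open>A\<close>, \<open>B\<close> move across the inner product as adjoints. The cases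
  \<open>K = V ** N\<close> and \<open>K = mat 1\<close> describe the candidate extension and
  \<open>G\<close>.\<close>

lemma kernel_eq_orthogonal_comp:
  fixes A B :: "real^'n^'p" and K :: "real^'m^'p"
  shows "{(x, x'). (transpose K ** A) *v x + (transpose K ** B) *v x' = 0}
    = (range (\<lambda>y. row_map A B (K *v y)))\<^sup>\<bottom>"
proof -
  have "(transpose K ** A) *v x + (transpose K ** B) *v x' = 0 \<longleftrightarrow>
      (\<forall>y. (x, x') \<bullet> row_map A B (K *v y) = 0)" for x x'
  proof -
    have "(x, x') \<bullet> row_map A B (K *v y) = y \<bullet> (transpose K *v (A *v x + B *v x'))" for y
      using inner_row_map[of A B "K *v y" x x']
        inner_matrix_vector_mult[of "transpose K" y "A *v x + B *v x'"]
      by (simp only: inner_commute[of "(x, x')"] transpose_transpose)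
    then show ?thesis
      by (metis (no_types, lifting) matrix_vector_mul_assoc matrix_vector_right_distrib
          inner_eq_zero_iff inner_zero_right)
  qed
  then show ?thesis
    by (auto simp: orthogonal_comp_iff)
qed

section \<open>Parametrisation of the maximally monotone linear extensions\<close>

theorem theorem3p7:
  fixes A B :: "real^'n^'p::{finite,linorder}"
    and G G' :: "real^'n \<Rightarrow> (real^'n) set"
    and v :: "'p \<Rightarrow> real^'p::{finite,linorder}"
    and lam :: "'p \<Rightarrow> real"
    and V :: "real^'p::{finite,linorder}^'p::{finite,linorder}"
  assumes "rank (block_row A B) = CARD('p)"
    and "linear_relation G"
    and "gra G = {(x, x'). A *v x + B *v x' = 0}"
    and "orthonormal_basis v"
    and "\<forall>i. eigenvector (A ** transpose B + B ** transpose A) (v i) (lam i)"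
    and "\<forall>i j. i < j \<and> lam j > 0 \<longrightarrow> lam i > 0"
    and "V = matrix_of_columns v"
    and "monotone_operator G"
    and "linear_relation G'"
  shows "maximally_monotone G' \<and> extension_of G' G \<longleftrightarrow>
    (\<exists>N :: real^'p::{finite,linorder}^'p::{finite,linorder}. rank N = CARD('n) \<and>
       negative_semidefinite (transpose N ** diag lam ** N) \<and>
       gra G' = {(x, x'). (transpose N ** transpose V ** A) *v x
                        + (transpose N ** transpose V ** B) *v x' = 0})"
proof -
  let ?M = "A ** transpose B + B ** transpose A"
  let ?f = "row_map A B"
  let ?W = "gra G'"
  have W: "subspace ?W"
    using assms(9) by (simp add: linear_relation_def)
  have VtV: "transpose V ** V = mat 1"
    using orthonormal_columns[OF assms(4)] assms(7) by simp
  then have VVt: "V ** transpose V = mat 1"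
    by (simp add: matrix_left_right_inverse)
  have MV: "?M ** V = V ** diag lam"
    using eigenvector_columns[OF assms(5)] assms(7) by simp
  have inj_V: "inj ((*v) V)"
    by (metis VtV inj_on_inverseI matrix_vector_mul_assoc matrix_vector_mul_lid)
  have inj_f: "inj ?f"
    using inj_row_map[OF assms(1)] .
  have form: "z \<bullet> (diag lam *v z) = 2 * (fst (?f (V *v z)) \<bullet> snd (?f (V *v z)))" for z
  proof -
    have "2 * (fst (?f (V *v z)) \<bullet> snd (?f (V *v z))) = (V *v z) \<bullet> (?M *v (V *v z))"
      by (simp only: row_map_quadratic_form)
    also have "\<dots> = (V *v z) \<bullet> (V *v (diag lam *v z))"
      by (simp only: matrix_vector_mul_assoc MV)
    also have "\<dots> = (transpose V *v (V *v z)) \<bullet> (diag lam *v z)"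
      by (simp only: inner_matrix_vector_mult)
    also have "\<dots> = z \<bullet> (diag lam *v z)"
      by (simp only: matrix_vector_mul_assoc VtV matrix_vector_mul_lid)
    finally show ?thesis by simp
  qed
  have kernel: "{(x, x'). (transpose N ** transpose V ** A) *v x
        + (transpose N ** transpose V ** B) *v x' = 0} = (range (\<lambda>y. ?f (V *v (N *v y))))\<^sup>\<bottom>"
    for N :: "real^'p::{finite,linorder}^'p::{finite,linorder}"
    using kernel_eq_orthogonal_comp[of "V ** N" A B]
    by (simp add: matrix_transpose_mul matrix_vector_mul_assoc)
  have neg: "negative_semidefinite (transpose N ** diag lam ** N) \<longleftrightarrow>
      semidefinite_on (- 1) (range (\<lambda>y. ?f (V *v (N *v y))))" for N :: "real^'p::{finite,linorder}^'p::{finite,linorder}"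
    by (simp add: negative_semidefinite_congruence_iff form semidefinite_on_def mult_le_0_iff)
  have lin_fVN: "linear (\<lambda>y. ?f (V *v (N *v y)))" for N :: "real^'p::{finite,linorder}^'p::{finite,linorder}"
    using linear_compose[OF matrix_vector_mul_linear[of "V ** N"] linear_row_map[of A B]]
    by (simp add: o_def matrix_vector_mul_assoc)
  have dim_range: "dim (range (\<lambda>y. ?f (V *v (N *v y)))) = rank N" for N :: "real^'p::{finite,linorder}^'p::{finite,linorder}"
  proof -
    have "linear (\<lambda>z. ?f (V *v z))"
      using linear_compose[OF matrix_vector_mul_linear[of V] linear_row_map[of A B]]
      by (simp add: o_def)
    moreover have "inj (\<lambda>z. ?f (V *v z))"
      using inj_f inj_V by (auto simp: inj_def)
    ultimately have "dim ((\<lambda>z. ?f (V *v z)) ` range ((*v) N)) = dim (range ((*v) N))"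
      by (intro dim_image_eq) (auto intro: inj_on_subset)
    then show ?thesis
      by (simp add: image_image rank_dim_range)
  qed
  have gra_G: "gra G = (range ?f)\<^sup>\<bottom>"
    using kernel_eq_orthogonal_comp[of "mat 1" A B] assms(3) by simp
  show ?thesis
  proof
    assume "maximally_monotone G' \<and> extension_of G' G"
    then have dim: "dim (?W\<^sup>\<bottom>) = CARD('n)" and sd: "semidefinite_on (- 1) (?W\<^sup>\<bottom>)"
      and ext: "gra G \<subseteq> ?W"
      using maximally_monotone_linear_relation_iff[OF assms(9)] by (auto simp: extension_of_def)
    \<comment> \<open>Complements reverse the inclusion of graphs, which places the complement of
      \<open>?W\<close> in the row space.\<close>
    have "?W\<^sup>\<bottom> \<subseteq> (range ?f)\<^sup>\<bottom>\<^sup>\<bottom>"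
      using orthogonal_comp_anti_mono[OF ext] gra_G by simp
    then have W_range: "?W\<^sup>\<bottom> \<subseteq> range ?f"
      by (simp add: orthogonal_comp_self linear_row_map linear_subspace_image)
    let ?U = "?f -` (?W\<^sup>\<bottom>)"
    have "subspace ?U"
      by (intro linear_subspace_vimage linear_row_map subspace_orthogonal_comp)
    \<comment> \<open>\<open>P\<close> is a linear projection of the whole coefficient space onto
      \<open>?U\<close>; using a projection rather than a basis makes the resulting matrix
      square.\<close>
    then obtain P where P: "range P \<subseteq> ?U" "linear P" "\<And>u. u \<in> ?U \<Longrightarrow> P u = u"
      using linear_exists_left_inverse_on[of "\<lambda>x::real^'p::{finite,linorder}. x" ?U] by (auto simp: linear_ident)
    have range_P: "range P = ?U"
      using P(1,3) by (metis rangeI subsetI subset_antisym)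
    \<comment> \<open>Solves \<open>V ** ?N = matrix P\<close>, since the inverse of
      \<open>V\<close> is its transpose.\<close>
    let ?N = "transpose V ** matrix P"
    have VN: "V *v (?N *v y) = P y" for y
      by (simp add: matrix_vector_mul_assoc matrix_mul_assoc VVt matrix_works P(2) linear_matrix_vector_mul_eq)
    have "range (\<lambda>y. ?f (V *v (?N *v y))) = ?f ` range P"
      by (simp only: VN image_image)
    also have "\<dots> = ?W\<^sup>\<bottom>"
      using range_P W_range by auto
    finally have range_N: "range (\<lambda>y. ?f (V *v (?N *v y))) = ?W\<^sup>\<bottom>" .
    show "\<exists>N :: real^'p::{finite,linorder}^'p::{finite,linorder}. rank N = CARD('n) \<and>
       negative_semidefinite (transpose N ** diag lam ** N) \<and>
       gra G' = {(x, x'). (transpose N ** transpose V ** A) *v x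
                        + (transpose N ** transpose V ** B) *v x' = 0}"
    proof (intro exI conjI)
      show "rank ?N = CARD('n)"
        using dim_range[of ?N] range_N dim by metis
      show "negative_semidefinite (transpose ?N ** diag lam ** ?N)"
        unfolding neg range_N by (rule sd)
      show "gra G' = {(x, x'). (transpose ?N ** transpose V ** A) *v x
                        + (transpose ?N ** transpose V ** B) *v x' = 0}"
        unfolding kernel range_N by (simp add: orthogonal_comp_self[OF W])
    qed
  next
    assume "\<exists>N :: real^'p::{finite,linorder}^'p::{finite,linorder}. rank N = CARD('n) \<and>
       negative_semidefinite (transpose N ** diag lam ** N) \<and>
       gra G' = {(x, x'). (transpose N ** transpose V ** A) *v x
                        + (transpose N ** transpose V ** B) *v x' = 0}"
    then obtain N :: "real^'p::{finite,linorder}^'p::{finite,linorder}" where N: "rank N = CARD('n)"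
        "semidefinite_on (- 1) (range (\<lambda>y. ?f (V *v (N *v y))))"
        "?W = (range (\<lambda>y. ?f (V *v (N *v y))))\<^sup>\<bottom>"
      unfolding kernel neg by blast
    have "?W\<^sup>\<bottom> = range (\<lambda>y. ?f (V *v (N *v y)))"
      unfolding N(3) by (intro orthogonal_comp_self linear_subspace_image lin_fVN subspace_UNIV)
    then have "maximally_monotone G'"
      using N(1,2) dim_range[of N] by (simp add: maximally_monotone_linear_relation_iff[OF assms(9)])
    \<comment> \<open>The range through \<open>V\<close> and \<open>N\<close> lies in
      \<open>range ?f\<close>, so its complement contains that of \<open>range ?f\<close>.\<close>
    moreover have "gra G \<subseteq> ?W"
      unfolding N(3) gra_G by (rule orthogonal_comp_anti_mono) auto
    ultimately show "maximally_monotone G' \<and> extension_of G' G"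
      by (simp add: extension_of_def)
  qed
qed

end
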